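(* Let $(\mathcal{X},d)$ be a complete separable metric space, let $\lambda>0$, and let $c_\lambda(x,y)=\min\{d(x,y),2\lambda\}$ for $x,y\in\mathcal{X}$. Then $$W^{(\lambda)}(\mu,\nu):=\inf_{\pi\in\Pi(\mu,\nu)}\int_{\mathcal{X}\times\mathcal{X}}c_\lambda(x,y)\,d\pi(x,y)$$ is a metric on $\mathcal{P}(\mathcal{X})$.
   Context: $\mathcal{P}(\mathcal{X})$ is the set of all Borel probability measures on $\mathcal{X}$; $\Pi(\mu,\nu)$ is the set of Borel probability measures on $\mathcal{X}\times\mathcal{X}$ with first marginal $\mu$ and second marginal $\nu$. *)

theory Defs
  imports "HOL-Probability.Probability"
begin

definition borel_probs :: "'a::topological_space measure set" where
  "borel_probs = {\<mu>. prob_space \<mu> \<and> sets \<mu> = sets borel}"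

definition couplings ::
    "'a::topological_space measure \<Rightarrow> 'a measure \<Rightarrow> ('a \<times> 'a) measure set" where
  "couplings \<mu> \<nu> = {\<pi> \<in> borel_probs. distr \<pi> borel fst = \<mu> \<and> distr \<pi> borel snd = \<nu>}"

definition trunc_cost :: "real \<Rightarrow> 'a::metric_space \<Rightarrow> 'a \<Rightarrow> real" where
  "trunc_cost l x y = min (dist x y) (2 * l)"

text \<open>The library predicate \<^const>\<open>Metric_space\<close> asks for nonnegativity and symmetry on the
  whole type, also off the carrier, where the set of couplings is empty and the real-valued
  infimum has no determined value. Hence the convention that the distance is 0 unless both
  arguments are Borel probability measures.\<close>

definition robust_W ::
    "real \<Rightarrow> 'a::metric_space measure \<Rightarrow> 'a measure \<Rightarrow> real" where
  "robust_W l \<mu> \<nu> =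
     (if \<mu> \<in> borel_probs \<and> \<nu> \<in> borel_probs
      then (INF \<pi>\<in>couplings \<mu> \<nu>. \<integral>(x, y). trunc_cost l x y \<partial>\<pi>)
      else 0)"

end

theory Submission
  imports Defs
begin

text \<open>The truncated distance is itself a bounded metric, and the infimum of its mean over couplings
  inherits the metric axioms: swapping the two coordinates of a coupling gives symmetry, and the
  diagonal coupling gives distance zero from a measure to itself. Two axioms need an argument.

  For the triangle inequality one glues a coupling of \<open>\<mu>\<close> and \<open>\<nu>\<close> to a coupling of \<open>\<nu>\<close> and \<open>\<rho>\<close>.
  Exact gluing along the common marginal \<open>\<nu>\<close> rests on disintegration of measures. Since the distance is
  an infimum, it suffices to glue up to an error \<open>e\<close>: by separability the space has a
  countable Borel partition into cells of diameter at most \<open>e\<close> (\<open>fine_countable_partition\<close>), and one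
  glues only along the index of the cell, which is a countably valued random variable. There the
  conditional product of the two couplings is an explicit density with respect to their product
  (\<open>gluing_countable\<close>). A point of the glued measure consists of \<open>(x, y)\<close> and \<open>(y', z)\<close> with \<open>y\<close>
  and \<open>y'\<close> in the same cell, so \<open>(x, z)\<close> is a coupling of \<open>\<mu>\<close> and \<open>\<rho>\<close> whose cost exceeds the sum
  of the two given costs by at most \<open>e\<close> (\<open>approximate_gluing\<close>).

  For the separation of distinct measures, a Lipschitz function with values in the unit interval
  varies between two points by at most a constant times their truncated distance. Hence its means
  under \<open>\<mu>\<close> and \<open>\<nu>\<close> differ by at most that constant times the cost of any coupling
  (\<open>integral_diff_le_transport_cost\<close>). At distance zero the means therefore agree, and such functions
  determine a Borel probability measure (\<open>borel_probs_eqI\<close>).\<close>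

section \<open>Couplings and their cost\<close>

abbreviation transport_cost :: "real \<Rightarrow> ('a::metric_space \<times> 'a) measure \<Rightarrow> real" where
  "transport_cost l \<pi> \<equiv> \<integral>(x, y). trunc_cost l x y \<partial>\<pi>"

lemma borel_probsD:
  assumes "\<mu> \<in> borel_probs"
  shows "prob_space \<mu>" "sets \<mu> = sets borel" "space \<mu> = UNIV"
  using assms sets_eq_imp_space_eq[of \<mu> borel] by (auto simp: borel_probs_def)

lemma borel_probsI:
  assumes "prob_space \<mu>" "sets \<mu> = sets borel"
  shows "\<mu> \<in> borel_probs"
  using assms by (simp add: borel_probs_def)

lemma couplingsD:
  assumes "\<pi> \<in> couplings \<mu> \<nu>"
  shows "\<pi> \<in> borel_probs" "distr \<pi> borel fst = \<mu>" "distr \<pi> borel snd = \<nu>"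
  using assms by (simp_all add: couplings_def)

lemma trunc_cost_nonneg: "l \<ge> 0 \<Longrightarrow> trunc_cost l x y \<ge> 0"
  by (simp add: trunc_cost_def)

lemma trunc_cost_triangle:
  assumes "l \<ge> 0"
  shows "trunc_cost l x z \<le> trunc_cost l x y + trunc_cost l y z"
  using assms dist_triangle[of x z y] zero_le_dist[of x y] zero_le_dist[of y z]
  unfolding trunc_cost_def by linarith

lemma sets_borel_prod:
  "sets (borel \<Otimes>\<^sub>M borel) =
     sets (borel :: ('a::second_countable_topology \<times> 'b::second_countable_topology) measure)"
  by (simp only: borel_prod)

lemma measurable_fst_borel:
  "(fst :: 'a::topological_space \<times> 'b::topological_space \<Rightarrow> 'a) \<in> borel \<rightarrow>\<^sub>M borel"
  by (intro borel_measurable_continuous_onI continuous_intros)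

lemma measurable_snd_borel:
  "(snd :: 'a::topological_space \<times> 'b::topological_space \<Rightarrow> 'b) \<in> borel \<rightarrow>\<^sub>M borel"
  by (intro borel_measurable_continuous_onI continuous_intros)

lemma measurable_trunc_cost [measurable]:
  "(\<lambda>(x, y). trunc_cost l x y) \<in> borel_measurable
     (borel :: ('a::{metric_space, second_countable_topology} \<times> 'a) measure)"
  unfolding trunc_cost_def case_prod_beta'
  by (intro borel_measurable_continuous_onI continuous_intros)

lemma integrable_trunc_cost:
  fixes \<pi> :: "('a::{metric_space, second_countable_topology} \<times> 'a) measure"
  assumes "\<pi> \<in> borel_probs" "l \<ge> 0"
  shows "integrable \<pi> (\<lambda>(x, y). trunc_cost l x y)"
proof -
  interpret prob_space \<pi> using borel_probsD[OF assms(1)] by simp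
  have "(\<lambda>(x, y). trunc_cost l x y) \<in> borel_measurable \<pi>"
    using measurable_trunc_cost[of l] borel_probsD(2)[OF assms(1)]
    by (simp cong: measurable_cong_sets)
  then show ?thesis
    using assms(2) by (intro integrable_const_bound[of _ "2 * l"]) (auto simp: trunc_cost_def)
qed

lemma transport_cost_nonneg: "l \<ge> 0 \<Longrightarrow> transport_cost l \<pi> \<ge> 0"
  by (intro Bochner_Integration.integral_nonneg) (auto simp: trunc_cost_nonneg)

lemma product_coupling:
  fixes \<mu> \<nu> :: "'a::{metric_space, second_countable_topology} measure"
  assumes "\<mu> \<in> borel_probs" "\<nu> \<in> borel_probs"
  shows "\<mu> \<Otimes>\<^sub>M \<nu> \<in> couplings \<mu> \<nu>"
proof -
  note M = borel_probsD[OF assms(1)] and N = borel_probsD[OF assms(2)]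
  interpret M: prob_space \<mu> by (rule M)
  interpret N: prob_space \<nu> by (rule N)
  interpret pair_prob_space \<mu> \<nu> ..
  have s: "sets (\<mu> \<Otimes>\<^sub>M \<nu>) = sets borel"
    using sets_pair_measure_cong[OF M(2) N(2)] sets_borel_prod by (rule trans)
  have "distr (\<mu> \<Otimes>\<^sub>M \<nu>) borel fst = distr (\<mu> \<Otimes>\<^sub>M \<nu>) \<mu> fst"
    using M by (intro distr_cong) auto
  moreover have "distr (\<mu> \<Otimes>\<^sub>M \<nu>) borel snd = distr (\<mu> \<Otimes>\<^sub>M \<nu>) \<nu> snd"
    using N by (intro distr_cong) auto
  moreover have "distr (\<mu> \<Otimes>\<^sub>M \<nu>) \<nu> snd = \<nu>"
  proof (rule measure_eqI)
    fix A assume "A \<in> sets (distr (\<mu> \<Otimes>\<^sub>M \<nu>) \<nu> snd)"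
    then have A: "A \<in> sets \<nu>" by simp
    then have "snd -` A \<inter> space (\<mu> \<Otimes>\<^sub>M \<nu>) = space \<mu> \<times> A"
      using sets.sets_into_space by (auto simp: space_pair_measure)
    with A show "emeasure (distr (\<mu> \<Otimes>\<^sub>M \<nu>) \<nu> snd) A = emeasure \<nu> A"
      by (simp add: emeasure_distr N.emeasure_pair_measure_Times M.emeasure_space_1)
  qed simp
  ultimately show ?thesis
    using s prob_space_axioms N.distr_pair_fst[of \<mu>]
    by (auto simp: couplings_def intro: borel_probsI)
qed

lemma diagonal_coupling:
  fixes \<mu> :: "'a::{metric_space, second_countable_topology} measure"
  assumes "\<mu> \<in> borel_probs"
  shows "distr \<mu> borel (\<lambda>x. (x, x)) \<in> couplings \<mu> \<mu>"
proof -
  note M = borel_probsD[OF assms]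
  interpret prob_space \<mu> by (rule M)
  have [measurable]: "(\<lambda>x. (x, x)) \<in> \<mu> \<rightarrow>\<^sub>M (borel :: ('a \<times> 'a) measure)"
    unfolding borel_prod[symmetric] using measurable_ident_sets[OF M(2)] by simp
  have "prob_space (distr \<mu> borel (\<lambda>x. (x, x)))"
    by (rule prob_space_distr) simp
  moreover have "distr \<mu> borel (\<lambda>x. x) = \<mu>"
    by (rule distr_id2) (simp add: M)
  ultimately show ?thesis
    by (auto simp: couplings_def distr_distr[OF measurable_fst_borel]
        distr_distr[OF measurable_snd_borel] o_def intro!: borel_probsI)
qed

lemma swap_coupling:
  fixes \<mu> \<nu> :: "'a::{metric_space, second_countable_topology} measure"
  assumes "\<pi> \<in> couplings \<mu> \<nu>"
  shows "distr \<pi> borel prod.swap \<in> couplings \<nu> \<mu>"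
    and "transport_cost l (distr \<pi> borel prod.swap) = transport_cost l \<pi>"
proof -
  note P = couplingsD[OF assms]
  note B = borel_probsD[OF P(1)]
  interpret prob_space \<pi> by (rule B)
  have sw [measurable]: "prod.swap \<in> \<pi> \<rightarrow>\<^sub>M (borel :: ('a \<times> 'a) measure)"
    unfolding measurable_cong_sets[OF B(2) refl] prod.swap_def
    by (intro borel_measurable_continuous_onI continuous_intros)
  have "prob_space (distr \<pi> borel prod.swap)"
    by (rule prob_space_distr) simp
  then show "distr \<pi> borel prod.swap \<in> couplings \<nu> \<mu>"
    using P by (auto simp: couplings_def distr_distr[OF measurable_fst_borel sw]
        distr_distr[OF measurable_snd_borel sw] o_def intro!: borel_probsI)
  show "transport_cost l (distr \<pi> borel prod.swap) = transport_cost l \<pi>"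
    by (subst integral_distr[OF sw measurable_trunc_cost])
      (simp add: case_prod_beta' trunc_cost_def dist_commute)
qed

section \<open>Gluing along a countable partition\<close>

text \<open>The atoms of mass zero are countably many, so their union is a null set.\<close>

lemma AE_pos_atom:
  fixes f :: "'a \<Rightarrow> nat"
  assumes [measurable]: "f \<in> M \<rightarrow>\<^sub>M count_space UNIV"
  shows "AE p in M. emeasure M (f -` {f p} \<inter> space M) \<noteq> 0"
proof -
  have "AE p in M. \<forall>i. emeasure M (f -` {i} \<inter> space M) = 0 \<longrightarrow> f p \<noteq> i"
  proof (subst AE_all_countable, intro allI)
    fix i
    have "f -` {i} \<inter> space M \<in> sets M" using assms by (rule measurable_sets) simp
    then show "AE p in M. emeasure M (f -` {i} \<inter> space M) = 0 \<longrightarrow> f p \<noteq> i"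
      by (cases "emeasure M (f -` {i} \<inter> space M) = 0")
        (auto intro!: AE_I'[of "f -` {i} \<inter> space M"] simp: null_sets_def)
  qed
  then show ?thesis by eventually_elim auto
qed

text \<open>Two random variables with the same law on a countable set can be realised as almost surely
  equal. The measure \<open>\<gamma>\<close> below is the conditional product: draw the common value \<open>i\<close> from that law,
  then draw \<open>p\<close> and \<open>q\<close> independently, conditioned on \<open>f p = i\<close> and on \<open>g q = i\<close>. With \<open>W i\<close> the
  probability of \<open>i\<close>, its density with respect to the product is
  \<open>W i * (1 / W i) * (1 / W i) = 1 / W i\<close> where \<open>f p = i = g q\<close>, and \<open>0\<close> elsewhere. Integrating out
  one coordinate gives \<open>1\<close> almost everywhere, so both marginals are the given measures.\<close>

lemma gluing_countable:
  fixes f :: "'a \<Rightarrow> nat" and g :: "'b \<Rightarrow> nat"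
  assumes "prob_space M" "prob_space N"
    and f [measurable]: "f \<in> M \<rightarrow>\<^sub>M count_space UNIV"
    and g [measurable]: "g \<in> N \<rightarrow>\<^sub>M count_space UNIV"
    and law: "distr M (count_space UNIV) f = distr N (count_space UNIV) g"
  obtains \<gamma> where "sets \<gamma> = sets (M \<Otimes>\<^sub>M N)" "distr \<gamma> M fst = M" "distr \<gamma> N snd = N"
    "AE (p, q) in \<gamma>. f p = g q"
proof -
  interpret M: prob_space M by fact
  interpret N: prob_space N by fact
  interpret pair_prob_space M N ..
  define W where "W i = emeasure N (g -` {i} \<inter> space N)" for i
  have WM: "W i = emeasure M (f -` {i} \<inter> space M)" for i
    using arg_cong[OF law, of "\<lambda>L. emeasure L {i}"] by (simp add: W_def emeasure_distr)
  have inv: "inverse (W i) * W i = 1" if "W i \<noteq> 0" for i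
  proof -
    have "W i < top" by (simp add: W_def less_top[symmetric])
    from ennreal_divide_self[OF that this] show ?thesis
      by (simp add: divide_ennreal_def mult.commute)
  qed
  define h where "h = (\<lambda>(p, q). if f p = g q then inverse (W (f p)) else 0)"
  \<comment> \<open>The coincidence set is a countable union of measurable rectangles.\<close>
  have [measurable]: "Measurable.pred (M \<Otimes>\<^sub>M N) (\<lambda>z. f (fst z) = g (snd z))"
  proof -
    have "Measurable.pred (M \<Otimes>\<^sub>M N) (\<lambda>z. \<exists>i. f (fst z) = i \<and> g (snd z) = i)"
      by measurable
    also have "(\<lambda>z. \<exists>i. f (fst z) = i \<and> g (snd z) = i) = (\<lambda>z. f (fst z) = g (snd z))"
      by auto
    finally show ?thesis .
  qed
  have [measurable]: "(\<lambda>z. W (f (fst z))) \<in> borel_measurable (M \<Otimes>\<^sub>M N)"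
    by (rule measurable_compose[where N="count_space UNIV"]) auto
  have [measurable]: "h \<in> borel_measurable (M \<Otimes>\<^sub>M N)"
    unfolding h_def case_prod_beta' by measurable
  define \<gamma> where "\<gamma> = density (M \<Otimes>\<^sub>M N) h"
  have intN: "AE p in M. (\<integral>\<^sup>+q. h (p, q) \<partial>N) = 1"
  proof -
    have "(\<integral>\<^sup>+q. h (p, q) \<partial>N) = inverse (W (f p)) * W (f p)" for p
    proof -
      have "(\<integral>\<^sup>+q. h (p, q) \<partial>N) = (\<integral>\<^sup>+q. inverse (W (f p)) * indicator (g -` {f p} \<inter> space N) q \<partial>N)"
        by (intro nn_integral_cong) (auto simp: h_def indicator_def)
      also have "\<dots> = inverse (W (f p)) * W (f p)"
        unfolding W_def by (intro nn_integral_cmult_indicator) measurable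
      finally show ?thesis .
    qed
    then show ?thesis
      using AE_pos_atom[OF f] by (auto simp: WM[symmetric] inv elim: eventually_mono)
  qed
  have intM: "AE q in N. (\<integral>\<^sup>+p. h (p, q) \<partial>M) = 1"
  proof -
    have "(\<integral>\<^sup>+p. h (p, q) \<partial>M) = inverse (W (g q)) * W (g q)" for q
    proof -
      have "(\<integral>\<^sup>+p. h (p, q) \<partial>M) = (\<integral>\<^sup>+p. inverse (W (g q)) * indicator (f -` {g q} \<inter> space M) p \<partial>M)"
        by (intro nn_integral_cong) (auto simp: h_def indicator_def)
      also have "\<dots> = inverse (W (g q)) * W (g q)"
        unfolding WM by (intro nn_integral_cmult_indicator) measurable
      finally show ?thesis .
    qed
    then show ?thesis
      using AE_pos_atom[OF g] by (auto simp: W_def[symmetric] inv elim: eventually_mono)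
  qed
  show thesis
  proof
    show "sets \<gamma> = sets (M \<Otimes>\<^sub>M N)" by (simp add: \<gamma>_def)
    show "distr \<gamma> M fst = M"
    proof (rule measure_eqI)
      fix A assume "A \<in> sets (distr \<gamma> M fst)"
      then have A [measurable]: "A \<in> sets M" by simp
      have "emeasure (distr \<gamma> M fst) A = (\<integral>\<^sup>+z. indicator A (fst z) \<partial>\<gamma>)"
        by (subst nn_integral_distr[symmetric, where M=\<gamma> and M'=M]) (auto simp: \<gamma>_def)
      also have "\<dots> = (\<integral>\<^sup>+z. h z * indicator A (fst z) \<partial>(M \<Otimes>\<^sub>M N))"
        unfolding \<gamma>_def by (intro nn_integral_density) measurable
      also have "\<dots> = (\<integral>\<^sup>+p. \<integral>\<^sup>+q. h (p, q) * indicator A p \<partial>N \<partial>M)"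
        by (subst N.nn_integral_fst[symmetric]) auto
      also have "\<dots> = (\<integral>\<^sup>+p. (\<integral>\<^sup>+q. h (p, q) \<partial>N) * indicator A p \<partial>M)"
        by (intro nn_integral_cong nn_integral_multc) measurable
      also have "\<dots> = (\<integral>\<^sup>+p. indicator A p \<partial>M)"
        by (rule nn_integral_cong_AE) (use intN in eventually_elim, simp)
      finally show "emeasure (distr \<gamma> M fst) A = emeasure M A" by simp
    qed simp
    show "distr \<gamma> N snd = N"
    proof (rule measure_eqI)
      fix A assume "A \<in> sets (distr \<gamma> N snd)"
      then have A [measurable]: "A \<in> sets N" by simp
      have "emeasure (distr \<gamma> N snd) A = (\<integral>\<^sup>+z. indicator A (snd z) \<partial>\<gamma>)"
        by (subst nn_integral_distr[symmetric, where M=\<gamma> and M'=N]) (auto simp: \<gamma>_def)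
      also have "\<dots> = (\<integral>\<^sup>+z. h z * indicator A (snd z) \<partial>(M \<Otimes>\<^sub>M N))"
        unfolding \<gamma>_def by (intro nn_integral_density) measurable
      also have "\<dots> = (\<integral>\<^sup>+q. \<integral>\<^sup>+p. h (p, q) * indicator A q \<partial>M \<partial>N)"
        by (subst nn_integral_snd[symmetric]) auto
      also have "\<dots> = (\<integral>\<^sup>+q. (\<integral>\<^sup>+p. h (p, q) \<partial>M) * indicator A q \<partial>N)"
        by (intro nn_integral_cong nn_integral_multc) measurable
      also have "\<dots> = (\<integral>\<^sup>+q. indicator A q \<partial>N)"
        by (rule nn_integral_cong_AE) (use intM in eventually_elim, simp)
      finally show "emeasure (distr \<gamma> N snd) A = emeasure N A" by simp
    qed simp
    show "AE (p, q) in \<gamma>. f p = g q"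
      unfolding \<gamma>_def by (subst AE_density) (auto simp: h_def intro!: AE_I2 split: if_splits)
  qed
qed

text \<open>Send each point to the first member of a dense sequence that lies within \<open>e / 2\<close> of it.\<close>

lemma fine_countable_partition:
  fixes e :: real
  assumes "e > 0"
  obtains f :: "'a::{metric_space, second_countable_topology} \<Rightarrow> nat"
  where "f \<in> borel \<rightarrow>\<^sub>M count_space UNIV" "\<And>x y. f x = f y \<Longrightarrow> dist x y < e"
proof -
  obtain D :: "'a set" where D: "countable D" "\<And>X. open X \<Longrightarrow> X \<noteq> {} \<Longrightarrow> \<exists>d\<in>D. d \<in> X"
    using countable_dense_setE by blast
  then have ne: "D \<noteq> {}" using D(2)[of UNIV] by auto
  define a where "a = from_nat_into D"
  have ex: "\<exists>n. dist x (a n) < e / 2" for x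
  proof -
    obtain d where "d \<in> D" "d \<in> ball x (e/2)" using D(2)[of "ball x (e/2)"] assms by auto
    moreover obtain n where "a n = d"
      using range_from_nat_into[OF ne D(1)] \<open>d \<in> D\<close> unfolding a_def by (metis imageE)
    ultimately show ?thesis by auto
  qed
  define f where "f x = (LEAST n. dist x (a n) < e / 2)" for x
  have f: "dist x (a (f x)) < e / 2" for x
    unfolding f_def using ex[of x] by (rule LeastI_ex)
  show thesis
  proof
    show "f \<in> borel \<rightarrow>\<^sub>M count_space UNIV"
      unfolding f_def by measurable
    show "dist x y < e" if "f x = f y" for x y
      using f[of x] f[of y] that dist_triangle_half_r[of "a (f x)" x e y] by (simp add: dist_commute)
  qed
qed

text \<open>Both couplings see the law of the cell index under \<open>\<nu>\<close>, one through its second and the other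
  through its first coordinate, so they can be glued along it. Moving from \<open>y\<close> to \<open>y'\<close> inside one
  cell costs less than \<open>e\<close>.\<close>

lemma approximate_gluing:
  fixes \<mu> \<nu> \<rho> :: "'a::{metric_space, second_countable_topology} measure"
  assumes p1: "\<pi>\<^sub>1 \<in> couplings \<mu> \<nu>" and p2: "\<pi>\<^sub>2 \<in> couplings \<nu> \<rho>" and "l \<ge> 0" "e > 0"
  obtains \<pi> where "\<pi> \<in> couplings \<mu> \<rho>"
    "transport_cost l \<pi> \<le> transport_cost l \<pi>\<^sub>1 + transport_cost l \<pi>\<^sub>2 + e"
proof -
  obtain f :: "'a \<Rightarrow> nat" where f [measurable]: "f \<in> borel \<rightarrow>\<^sub>M count_space UNIV"
    and mesh: "\<And>x y. f x = f y \<Longrightarrow> dist x y < e"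
    using fine_countable_partition[OF \<open>e > 0\<close>] by blast
  note P = couplingsD[OF p1] and Q = couplingsD[OF p2]
  note PB = borel_probsD[OF P(1)] and QB = borel_probsD[OF Q(1)]
  have [measurable_cong]: "sets \<pi>\<^sub>1 = sets (borel \<Otimes>\<^sub>M borel)" "sets \<pi>\<^sub>2 = sets (borel \<Otimes>\<^sub>M borel)"
    unfolding sets_borel_prod using PB QB by simp_all
  have law: "distr \<pi>\<^sub>1 (count_space UNIV) (\<lambda>p. f (snd p)) = distr \<pi>\<^sub>2 (count_space UNIV) (\<lambda>q. f (fst q))"
  proof -
    have "distr \<pi>\<^sub>1 (count_space UNIV) (\<lambda>p. f (snd p)) = distr (distr \<pi>\<^sub>1 borel snd) (count_space UNIV) f"
      by (subst distr_distr) (auto simp: o_def)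
    also have "\<dots> = distr (distr \<pi>\<^sub>2 borel fst) (count_space UNIV) f"
      using P Q by simp
    also have "\<dots> = distr \<pi>\<^sub>2 (count_space UNIV) (\<lambda>q. f (fst q))"
      by (subst distr_distr) (auto simp: o_def)
    finally show ?thesis .
  qed
  obtain \<gamma> where \<gamma>: "sets \<gamma> = sets (\<pi>\<^sub>1 \<Otimes>\<^sub>M \<pi>\<^sub>2)" "distr \<gamma> \<pi>\<^sub>1 fst = \<pi>\<^sub>1" "distr \<gamma> \<pi>\<^sub>2 snd = \<pi>\<^sub>2"
      "AE (p, q) in \<gamma>. f (snd p) = f (fst q)"
    by (rule gluing_countable[OF PB(1) QB(1) _ _ law]) auto
  note \<gamma>(1)[measurable_cong]
  have "prob_space (distr \<gamma> \<pi>\<^sub>1 fst)" using \<gamma>(2) PB(1) by simp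
  then interpret \<gamma>: prob_space \<gamma> by (rule prob_space_distrD[rotated]) simp
  define \<pi> where "\<pi> = distr \<gamma> borel (\<lambda>(p, q). (fst p, snd q))"
  have m [measurable]: "(\<lambda>(p, q). (fst p, snd q)) \<in> \<gamma> \<rightarrow>\<^sub>M borel"
    unfolding borel_prod[symmetric] by measurable
  have "distr \<pi> borel fst = distr (distr \<gamma> \<pi>\<^sub>1 fst) borel fst"
    unfolding \<pi>_def by (subst (1 2) distr_distr) (auto simp: o_def case_prod_beta' borel_prod[symmetric])
  moreover have "distr \<pi> borel snd = distr (distr \<gamma> \<pi>\<^sub>2 snd) borel snd"
    unfolding \<pi>_def by (subst (1 2) distr_distr) (auto simp: o_def case_prod_beta' borel_prod[symmetric])
  moreover have "prob_space \<pi>"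
    unfolding \<pi>_def by (rule \<gamma>.prob_space_distr) simp
  ultimately have \<pi>: "\<pi> \<in> couplings \<mu> \<rho>"
    using P Q \<gamma> by (auto simp: couplings_def \<pi>_def intro!: borel_probsI)
  let ?c = "\<lambda>p :: 'a \<times> 'a. trunc_cost l (fst p) (snd p)"
  have c: "?c \<in> borel_measurable borel"
    using measurable_trunc_cost[of l, where 'a='a] by (simp add: case_prod_beta')
  have cP: "?c \<in> borel_measurable \<pi>\<^sub>1" and cQ: "?c \<in> borel_measurable \<pi>\<^sub>2"
    using c PB QB by (simp_all cong: measurable_cong_sets)
  have iP: "integrable \<gamma> (\<lambda>z. ?c (fst z))"
    using integrable_trunc_cost[OF P(1) \<open>l \<ge> 0\<close>] \<gamma>(2) cP
      integrable_distr_eq[of fst \<gamma> \<pi>\<^sub>1 ?c] by (simp add: case_prod_beta')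
  have iQ: "integrable \<gamma> (\<lambda>z. ?c (snd z))"
    using integrable_trunc_cost[OF Q(1) \<open>l \<ge> 0\<close>] \<gamma>(3) cQ
      integrable_distr_eq[of snd \<gamma> \<pi>\<^sub>2 ?c] by (simp add: case_prod_beta')
  have iR: "integrable \<gamma> (\<lambda>z. trunc_cost l (fst (fst z)) (snd (snd z)))"
    using integrable_trunc_cost[OF couplingsD(1)[OF \<pi>] \<open>l \<ge> 0\<close>]
      integrable_distr_eq[OF m c] by (simp add: case_prod_beta' \<pi>_def)
  have "transport_cost l \<pi> = (\<integral>z. trunc_cost l (fst (fst z)) (snd (snd z)) \<partial>\<gamma>)"
    using integral_distr[OF m c] by (simp add: case_prod_beta' \<pi>_def)
  also have "\<dots> \<le> (\<integral>z. ?c (fst z) + ?c (snd z) + e \<partial>\<gamma>)"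
  proof (rule integral_mono_AE)
    show "AE z in \<gamma>. trunc_cost l (fst (fst z)) (snd (snd z)) \<le> ?c (fst z) + ?c (snd z) + e"
      using \<gamma>(4)
    proof eventually_elim
      case (elim z)
      then have "dist (snd (fst z)) (fst (snd z)) < e"
        by (intro mesh) (simp add: case_prod_beta')
      then have "trunc_cost l (snd (fst z)) (fst (snd z)) \<le> e"
        by (simp add: trunc_cost_def)
      then show ?case
        using trunc_cost_triangle[OF \<open>l \<ge> 0\<close>, of "fst (fst z)" "snd (snd z)" "snd (fst z)"]
          trunc_cost_triangle[OF \<open>l \<ge> 0\<close>, of "snd (fst z)" "snd (snd z)" "fst (snd z)"]
        by simp
    qed
  qed (use iP iQ iR in auto)
  also have "\<dots> = (\<integral>z. ?c (fst z) \<partial>\<gamma>) + (\<integral>z. ?c (snd z) \<partial>\<gamma>) + e"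
    using iP iQ by (simp add: \<gamma>.prob_space)
  also have "(\<integral>z. ?c (fst z) \<partial>\<gamma>) = transport_cost l \<pi>\<^sub>1"
    using integral_distr[of fst \<gamma> \<pi>\<^sub>1 ?c] cP \<gamma>(2) by (simp add: case_prod_beta')
  also have "(\<integral>z. ?c (snd z) \<partial>\<gamma>) = transport_cost l \<pi>\<^sub>2"
    using integral_distr[of snd \<gamma> \<pi>\<^sub>2 ?c] cQ \<gamma>(3) by (simp add: case_prod_beta')
  finally show thesis using that \<pi> by simp
qed

section \<open>Separation of measures\<close>

text \<open>Below the truncation level \<open>2 * l\<close> the Lipschitz bound applies; above it the oscillation is at
  most \<open>1 = (1 / (2 * l)) * (2 * l)\<close>. This is the easy half of Kantorovich duality.\<close>

lemma integral_diff_le_transport_cost: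
  fixes \<mu> \<nu> :: "'a::{metric_space, second_countable_topology} measure" and \<phi> :: "'a \<Rightarrow> real"
  assumes \<pi>: "\<pi> \<in> couplings \<mu> \<nu>" and "l > 0"
    and \<phi> [measurable]: "\<phi> \<in> borel_measurable borel"
    and range: "\<And>x. 0 \<le> \<phi> x" "\<And>x. \<phi> x \<le> 1"
    and lip: "\<And>x y. \<bar>\<phi> x - \<phi> y\<bar> \<le> K * dist x y"
  shows "\<bar>(\<integral>x. \<phi> x \<partial>\<mu>) - (\<integral>x. \<phi> x \<partial>\<nu>)\<bar> \<le> max K (1 / (2 * l)) * transport_cost l \<pi>"
proof -
  note P = couplingsD[OF \<pi>]
  note PB = borel_probsD[OF P(1)]
  interpret prob_space \<pi> by (rule PB)
  have [measurable_cong]: "sets \<pi> = sets (borel \<Otimes>\<^sub>M borel)"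
    unfolding sets_borel_prod by (rule PB)
  have i1: "integrable \<pi> (\<lambda>p. \<phi> (fst p))" and i2: "integrable \<pi> (\<lambda>p. \<phi> (snd p))"
    using range by (auto intro!: integrable_const_bound[of _ 1])
  have pt: "\<bar>\<phi> x - \<phi> y\<bar> \<le> max K (1 / (2 * l)) * trunc_cost l x y" for x y
  proof (cases "dist x y \<le> 2 * l")
    case True
    have "K * dist x y \<le> max K (1 / (2 * l)) * dist x y"
      by (intro mult_right_mono) auto
    with True lip[of x y] show ?thesis by (simp add: trunc_cost_def)
  next
    case False
    have "\<bar>\<phi> x - \<phi> y\<bar> \<le> 1" using range[of x] range[of y] by linarith
    also have "1 = 1 / (2 * l) * (2 * l)" using \<open>l > 0\<close> by simp
    also have "\<dots> \<le> max K (1 / (2 * l)) * (2 * l)"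
      using \<open>l > 0\<close> by (intro mult_right_mono) auto
    finally show ?thesis using False by (simp add: trunc_cost_def)
  qed
  have "(\<integral>x. \<phi> x \<partial>\<mu>) - (\<integral>x. \<phi> x \<partial>\<nu>) = (\<integral>p. \<phi> (fst p) \<partial>\<pi>) - (\<integral>p. \<phi> (snd p) \<partial>\<pi>)"
    unfolding P(2,3)[symmetric] by (subst (1 2) integral_distr) auto
  also have "\<dots> = (\<integral>p. \<phi> (fst p) - \<phi> (snd p) \<partial>\<pi>)"
    using i1 i2 by simp
  also have "\<bar>\<dots>\<bar> \<le> (\<integral>p. \<bar>\<phi> (fst p) - \<phi> (snd p)\<bar> \<partial>\<pi>)"
    by (rule integral_abs_bound)
  also have "\<dots> \<le> (\<integral>p. max K (1 / (2 * l)) * (case p of (x, y) \<Rightarrow> trunc_cost l x y) \<partial>\<pi>)"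
    using i1 i2 pt integrable_trunc_cost[OF P(1), of l] \<open>l > 0\<close>
    by (intro integral_mono) (auto simp: case_prod_beta')
  finally show ?thesis by simp
qed

text \<open>The indicator of a closed set \<open>F\<close> is the pointwise limit of the Lipschitz functions
  \<open>max 0 (1 - n * infdist x F)\<close>, so by dominated convergence the two measures agree on closed sets,
  which form an intersection-stable generator of the Borel sets.\<close>

lemma borel_probs_eqI:
  fixes \<mu> \<nu> :: "'a::metric_space measure"
  assumes \<mu>: "\<mu> \<in> borel_probs" and \<nu>: "\<nu> \<in> borel_probs"
    and eq: "\<And>(\<phi> :: 'a \<Rightarrow> real) K. \<lbrakk>\<And>x. 0 \<le> \<phi> x; \<And>x. \<phi> x \<le> 1; \<And>x y. \<bar>\<phi> x - \<phi> y\<bar> \<le> K * dist x y;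
        \<phi> \<in> borel_measurable borel\<rbrakk> \<Longrightarrow> (\<integral>x. \<phi> x \<partial>\<mu>) = (\<integral>x. \<phi> x \<partial>\<nu>)"
  shows "\<mu> = \<nu>"
proof -
  note M = borel_probsD[OF \<mu>] and N = borel_probsD[OF \<nu>]
  interpret M: prob_space \<mu> by (rule M)
  interpret N: prob_space \<nu> by (rule N)
  have closed: "emeasure \<mu> F = emeasure \<nu> F" if F: "closed F" for F
  \<comment> \<open>The distance to the empty set is 0 by convention, hence the separate case.\<close>
  proof (cases "F = {}")
    case False
    define \<phi> where "\<phi> n x = max 0 (1 - real n * infdist x F)" for n x
    have meas [measurable]: "\<phi> n \<in> borel_measurable borel" for n
      unfolding \<phi>_def by (intro borel_measurable_continuous_onI continuous_intros)
    have conv: "(\<lambda>n. \<phi> n x) \<longlonglongrightarrow> indicator F x" for x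
    proof (cases "x \<in> F")
      case True
      then show ?thesis by (simp add: \<phi>_def)
    next
      case False
      then have pos: "infdist x F > 0"
        using in_closed_iff_infdist_zero[OF F \<open>F \<noteq> {}\<close>, of x] infdist_nonneg[of x F] by linarith
      obtain n0 where n0: "1 < real n0 * infdist x F"
        using reals_Archimedean3[OF pos] by blast
      have "\<forall>\<^sub>F n in sequentially. \<phi> n x = 0"
        using eventually_ge_at_top[of n0]
      proof eventually_elim
        case (elim n)
        have "real n0 * infdist x F \<le> real n * infdist x F"
          using elim pos by (intro mult_right_mono) auto
        then show ?case using n0 by (simp add: \<phi>_def)
      qed
      then show ?thesis using False by (simp add: tendsto_eventually)
    qed
    have lim: "(\<lambda>n. \<integral>x. \<phi> n x \<partial>L) \<longlonglongrightarrow> measure L F" if L: "L \<in> borel_probs" for L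
    proof -
      note B = borel_probsD[OF L]
      interpret prob_space L by (rule B)
      have [measurable_cong]: "sets L = sets borel" by (rule B)
      have [measurable]: "F \<in> sets borel" using F by simp
      have "(\<lambda>n. \<integral>x. \<phi> n x \<partial>L) \<longlonglongrightarrow> (\<integral>x. indicator F x \<partial>L)"
      proof (rule integral_dominated_convergence[where w="\<lambda>_. 1"])
        show "AE x in L. norm (\<phi> n x) \<le> 1" for n
          by (auto simp: \<phi>_def infdist_nonneg)
      qed (auto simp: conv)
      then show ?thesis using B by simp
    qed
    have "(\<integral>x. \<phi> n x \<partial>\<mu>) = (\<integral>x. \<phi> n x \<partial>\<nu>)" for n
    proof (rule eq[where K="real n"])
      show "\<bar>\<phi> n x - \<phi> n y\<bar> \<le> real n * dist x y" for x y
      proof -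
        have "\<bar>\<phi> n x - \<phi> n y\<bar> \<le> \<bar>real n * infdist x F - real n * infdist y F\<bar>"
          unfolding \<phi>_def by linarith
        also have "\<dots> = real n * \<bar>infdist x F - infdist y F\<bar>"
          by (simp add: abs_mult right_diff_distrib[symmetric])
        also have "\<dots> \<le> real n * dist x y"
          using infdist_triangle[of x F y] infdist_triangle[of y F x]
          by (intro mult_left_mono) (auto simp: dist_commute)
        finally show ?thesis .
      qed
      show "\<phi> n \<in> borel_measurable borel" by (rule meas)
    qed (auto simp: \<phi>_def infdist_nonneg)
    then have "measure \<mu> F = measure \<nu> F"
      using lim[OF \<mu>] lim[OF \<nu>] by (simp add: LIMSEQ_unique)
    then show ?thesis by (simp add: M.emeasure_eq_measure N.emeasure_eq_measure)
  qed simp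
  show ?thesis
  proof (rule measure_eqI_generator_eq[where E="{F. closed F}" and \<Omega>=UNIV and A="\<lambda>_. UNIV"])
    show "Int_stable {F :: 'a set. closed F}" by (auto simp: Int_stable_def)
    show "sets \<mu> = sigma_sets UNIV {F. closed F}" "sets \<nu> = sigma_sets UNIV {F. closed F}"
      using M N by (simp_all add: borel_eq_closed)
  qed (auto simp: closed)
qed

section \<open>The metric\<close>

lemma robust_W_le:
  assumes "\<mu> \<in> borel_probs" "\<nu> \<in> borel_probs" "\<pi> \<in> couplings \<mu> \<nu>" "l \<ge> 0"
  shows "robust_W l \<mu> \<nu> \<le> transport_cost l \<pi>"
  unfolding robust_W_def using assms
  by (auto intro!: cINF_lower bdd_belowI[of _ 0] transport_cost_nonneg)

text \<open>Near-optimal couplings exist because the product measure makes the set of couplings nonempty.\<close>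

lemma robust_W_approx:
  fixes \<mu> \<nu> :: "'a::{metric_space, second_countable_topology} measure"
  assumes "\<mu> \<in> borel_probs" "\<nu> \<in> borel_probs" "e > 0"
  obtains \<pi> where "\<pi> \<in> couplings \<mu> \<nu>" "transport_cost l \<pi> < robust_W l \<mu> \<nu> + e"
proof -
  have "couplings \<mu> \<nu> \<noteq> {}" using product_coupling[OF assms(1,2)] by blast
  moreover have "Inf (transport_cost l ` couplings \<mu> \<nu>) < robust_W l \<mu> \<nu> + e"
    using assms by (simp add: robust_W_def)
  ultimately show thesis
    using that cInf_lessD[of "transport_cost l ` couplings \<mu> \<nu>"] by blast
qed

lemma robust_W_nonneg:
  fixes \<mu> \<nu> :: "'a::{metric_space, second_countable_topology} measure"
  assumes "l \<ge> 0"
  shows "robust_W l \<mu> \<nu> \<ge> 0"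
  unfolding robust_W_def using product_coupling[of \<mu> \<nu>] assms
  by (auto intro!: cINF_greatest transport_cost_nonneg)

lemma robust_W_commute_le:
  fixes \<mu> \<nu> :: "'a::{metric_space, second_countable_topology} measure"
  assumes "\<mu> \<in> borel_probs" "\<nu> \<in> borel_probs" "l \<ge> 0"
  shows "robust_W l \<mu> \<nu> \<le> robust_W l \<nu> \<mu>"
proof (rule field_le_epsilon)
  fix e :: real assume "e > 0"
  then obtain \<pi> where \<pi>: "\<pi> \<in> couplings \<nu> \<mu>" "transport_cost l \<pi> < robust_W l \<nu> \<mu> + e"
    using robust_W_approx[OF assms(2,1)] by blast
  show "robust_W l \<mu> \<nu> \<le> robust_W l \<nu> \<mu> + e"
    using robust_W_le[OF assms(1,2) swap_coupling(1)[OF \<pi>(1)] assms(3)]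
      swap_coupling(2)[OF \<pi>(1), of l] \<pi>(2) by linarith
qed

lemma robust_W_triangle:
  fixes \<mu> \<nu> \<rho> :: "'a::{metric_space, second_countable_topology} measure"
  assumes "\<mu> \<in> borel_probs" "\<nu> \<in> borel_probs" "\<rho> \<in> borel_probs" "l \<ge> 0"
  shows "robust_W l \<mu> \<rho> \<le> robust_W l \<mu> \<nu> + robust_W l \<nu> \<rho>"
proof (rule field_le_epsilon)
  fix e :: real assume "e > 0"
  then have e: "e / 3 > 0" by simp
  obtain \<pi>\<^sub>1 where p1: "\<pi>\<^sub>1 \<in> couplings \<mu> \<nu>" "transport_cost l \<pi>\<^sub>1 < robust_W l \<mu> \<nu> + e / 3"
    using robust_W_approx[OF assms(1,2) e] by blast
  obtain \<pi>\<^sub>2 where p2: "\<pi>\<^sub>2 \<in> couplings \<nu> \<rho>" "transport_cost l \<pi>\<^sub>2 < robust_W l \<nu> \<rho> + e / 3"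
    using robust_W_approx[OF assms(2,3) e] by blast
  obtain \<pi> where "\<pi> \<in> couplings \<mu> \<rho>"
    "transport_cost l \<pi> \<le> transport_cost l \<pi>\<^sub>1 + transport_cost l \<pi>\<^sub>2 + e / 3"
    using approximate_gluing[OF p1(1) p2(1) assms(4) e] by blast
  with p1(2) p2(2) robust_W_le[OF assms(1,3) _ assms(4), of \<pi>]
  show "robust_W l \<mu> \<rho> \<le> robust_W l \<mu> \<nu> + robust_W l \<nu> \<rho> + e" by linarith
qed

lemma robust_W_self:
  fixes \<mu> :: "'a::{metric_space, second_countable_topology} measure"
  assumes "\<mu> \<in> borel_probs" "l \<ge> 0"
  shows "robust_W l \<mu> \<mu> = 0"
proof -
  have "(\<lambda>x. (x, x)) \<in> \<mu> \<rightarrow>\<^sub>M (borel :: ('a \<times> 'a) measure)"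
    unfolding borel_prod[symmetric] using measurable_ident_sets[OF borel_probsD(2)[OF assms(1)]] by simp
  then have "transport_cost l (distr \<mu> borel (\<lambda>x. (x, x))) = 0"
    using assms(2) by (subst integral_distr) (auto simp: trunc_cost_def)
  then show ?thesis
    using robust_W_le[OF assms(1,1) diagonal_coupling[OF assms(1)] assms(2)]
      robust_W_nonneg[OF assms(2), of \<mu> \<mu>] by simp
qed

lemma robust_W_eq_0D:
  fixes \<mu> \<nu> :: "'a::{metric_space, second_countable_topology} measure"
  assumes "\<mu> \<in> borel_probs" "\<nu> \<in> borel_probs" "l > 0" "robust_W l \<mu> \<nu> = 0"
  shows "\<mu> = \<nu>"
proof (rule borel_probs_eqI[OF assms(1,2)])
  fix \<phi> :: "'a \<Rightarrow> real" and K
  assume \<phi>: "\<And>x. 0 \<le> \<phi> x" "\<And>x. \<phi> x \<le> 1" "\<And>x y. \<bar>\<phi> x - \<phi> y\<bar> \<le> K * dist x y"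
    "\<phi> \<in> borel_measurable borel"
  define C where "C = max K (1 / (2 * l))"
  have C: "C > 0" using \<open>l > 0\<close> by (auto simp: C_def less_max_iff_disj)
  have "\<bar>(\<integral>x. \<phi> x \<partial>\<mu>) - (\<integral>x. \<phi> x \<partial>\<nu>)\<bar> \<le> 0"
  proof (rule field_le_epsilon)
    fix e :: real assume "e > 0"
    \<comment> \<open>The cost can be made small enough to absorb the constant, since the infimum is 0.\<close>
    then obtain \<pi> where \<pi>: "\<pi> \<in> couplings \<mu> \<nu>" "transport_cost l \<pi> < e / C"
      using robust_W_approx[OF assms(1,2), of "e / C" l] C assms(4) by auto
    have "\<bar>(\<integral>x. \<phi> x \<partial>\<mu>) - (\<integral>x. \<phi> x \<partial>\<nu>)\<bar> \<le> C * transport_cost l \<pi>"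
      unfolding C_def
      by (rule integral_diff_le_transport_cost[OF \<pi>(1) \<open>l > 0\<close> \<phi>(4,1,2,3)])
    also have "\<dots> \<le> C * (e / C)" using \<pi>(2) C by (intro mult_left_mono) auto
    finally show "\<bar>(\<integral>x. \<phi> x \<partial>\<mu>) - (\<integral>x. \<phi> x \<partial>\<nu>)\<bar> \<le> 0 + e" using C by simp
  qed
  then show "(\<integral>x. \<phi> x \<partial>\<mu>) = (\<integral>x. \<phi> x \<partial>\<nu>)" by simp
qed

theorem theorem3p2:
  fixes l :: real
  assumes "l > 0"
  shows "Metric_space (borel_probs :: 'a::polish_space measure set) (robust_W l)"
proof
  have l: "l \<ge> 0" using assms by simp
  fix \<mu> \<nu> \<rho> :: "'a measure"
  show "0 \<le> robust_W l \<mu> \<nu>" by (rule robust_W_nonneg[OF l])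
  show "robust_W l \<mu> \<nu> = robust_W l \<nu> \<mu>"
  proof (cases "\<mu> \<in> borel_probs \<and> \<nu> \<in> borel_probs")
    case True
    then show ?thesis using l by (intro antisym robust_W_commute_le) auto
  qed (auto simp: robust_W_def)
  assume M: "\<mu> \<in> borel_probs" and N: "\<nu> \<in> borel_probs"
  show "robust_W l \<mu> \<nu> = 0 \<longleftrightarrow> \<mu> = \<nu>"
    using robust_W_eq_0D[OF M N assms] robust_W_self[OF M l] by auto
  assume R: "\<rho> \<in> borel_probs"
  show "robust_W l \<mu> \<rho> \<le> robust_W l \<mu> \<nu> + robust_W l \<nu> \<rho>"
    by (rule robust_W_triangle[OF M N R l])
qed

end
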